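(* For any differentiable choice welfare function $w:\mathbb R^2\to\mathbb R$, there exists a distribution $\theta$ of $(\epsilon_1,\epsilon_2)$ such that for all $(\mu_1,\mu_2)\in\mathbb R^2$ $$w(\mu_1,\mu_2)=\mathbb E_\theta\big[\max\{\mu_1+\epsilon_1,\ \mu_2+\epsilon_2\}\big].$$ In addition, if $w$ is superlinear, then there exists a distribution $\theta$ with finite expectation (i.e. $\mathbb E_\theta|\epsilon_1|<\infty$ and $\mathbb E_\theta|\epsilon_2|<\infty$) that satisfies this identity for all $(\mu_1,\mu_2)\in\mathbb R^2$.
   Context: A differentiable choice welfare function on $\mathbb R^n$ (here $n=2$) is a differentiable function $w:\mathbb R^n\to\mathbb R$ that is monotone ($\mu\ge\mu'$ componentwise implies $w(\mu)\ge w(\mu')$), translation invariant ($w(\mu+t\mathbf e)=w(\mu)+t$ for all $\mu\in\mathbb R^n$, $t\in\mathbb R$, where $\mathbf e$ is the all-ones vector) and convex. It is superlinear if there exist real numbers $b_1,\dots,b_n$ with $w(\mu)\ge\mu_i+b_i$ for all $\mu\in\mathbb R^n$ and all $i$. In the first assertion, $\theta$ is a probability distribution on $(\mathbb R\cup\{-\infty\})^2$, i.e. the components of $\epsilon$ are allowed to take the value $-\infty$. *)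

theory Defs
  imports "HOL-Probability.Probability"
begin

text \<open>The order on \<^typ>\<open>real^'n\<close> underlying \<^term>\<open>mono\<close> is the componentwise one.\<close>

definition differentiable_cwf :: "(real^'n \<Rightarrow> real) \<Rightarrow> bool" where
  "differentiable_cwf w \<longleftrightarrow>
     (\<forall>\<mu>. w differentiable (at \<mu>)) \<and>
     mono w \<and>
     (\<forall>\<mu> t. w (\<mu> + t *\<^sub>R (\<chi> i. 1)) = w \<mu> + t) \<and>
     convex_on UNIV w"

definition superlinear :: "(real^'n \<Rightarrow> real) \<Rightarrow> bool" where
  "superlinear w \<longleftrightarrow> (\<exists>b :: 'n \<Rightarrow> real. \<forall>\<mu> i. w \<mu> \<ge> \<mu> $ i + b i)"

definition real_or_minf :: "ereal set" where
  "real_or_minf = insert (-\<infinity>) (range ereal)"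

text \<open>
  The expectation \<open>E[X\<^sup>+] - E[X\<^sup>-]\<close> of an extended-real-valued random variable; note that
  \<^term>\<open>e2ennreal\<close> sends negative values to 0. Since \<open>\<infinity> - \<infinity> = \<infinity>\<close> in \<^typ>\<open>ereal\<close>, the value is
  a real number only if both parts have finite expectation, so that an equation
  \<open>ereal_expectation M X = ereal r\<close> includes the integrability of \<open>X\<close>.
\<close>

definition ereal_expectation :: "'a measure \<Rightarrow> ('a \<Rightarrow> ereal) \<Rightarrow> ereal" where
  "ereal_expectation M X =
     enn2ereal (\<integral>\<^sup>+ x. e2ennreal (X x) \<partial>M) - enn2ereal (\<integral>\<^sup>+ x. e2ennreal (- X x) \<partial>M)"

end

theory Submission
  imports Defs
begin

text \<open>
  By translation invariance, \<open>w \<mu> = g (\<mu>\<^sub>1 - \<mu>\<^sub>2) + \<mu>\<^sub>2\<close> where \<open>g x = w (x, 0)\<close>. Monotonicity and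
  convexity of \<open>w\<close> say that \<open>F = g'\<close> is nondecreasing with values in \<open>[0, 1]\<close>. So \<open>F\<close> is the
  distribution function of a random variable \<open>D\<close> with values in \<open>[-\<infinity>, \<infinity>]\<close>, which has an atom at
  \<open>-\<infinity>\<close> or at \<open>\<infinity>\<close> if the limit of \<open>F\<close> there is not 0 or not 1, respectively.
  It is realised as the quantile function of \<open>F\<close> at a uniform point of \<open>(0, 1)\<close>.

  The idea is to take \<open>\<epsilon>\<^sub>2 - \<epsilon>\<^sub>1 = D\<close> and to choose the level of the pair so that
  \<open>max \<epsilon>\<^sub>1 \<epsilon>\<^sub>2 = g 0\<close> is constant:
  \<open>\<epsilon>\<^sub>1 = g 0 - max 0 D\<close> and \<open>\<epsilon>\<^sub>2 = g 0 + min 0 D\<close>. Neither is ever \<open>\<infinity>\<close>, and they are not both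
  \<open>-\<infinity>\<close>. The variable \<open>max (x + \<epsilon>\<^sub>1) \<epsilon>\<^sub>2 - g 0\<close> is then bounded by \<open>\<bar>x\<bar>\<close>. For \<open>x \<ge> 0\<close> it is the
  length of \<open>{s \<in> [0, x]. D \<le> s}\<close>, so Tonelli's theorem and the fundamental theorem of calculus give
  its expectation \<open>\<integral>\<^sub>0\<^sup>x F = g x - g 0\<close>, and similarly for \<open>x < 0\<close>; this is
  \<open>expectation_gain\<close>.

  If \<open>w\<close> is superlinear, then \<open>x - g x\<close> and \<open>- g x\<close> are bounded above. For \<open>x = n\<close> and \<open>x = -n\<close> this
  bounds the expectations of the truncations at \<open>n\<close> of the positive and the negative part of \<open>D\<close>.
  By monotone convergence \<open>D\<close> is integrable (\<open>quantile_integrable\<close>), in particular almost surely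
  finite, and the same construction gives real-valued \<open>\<epsilon>\<^sub>1\<close> and \<open>\<epsilon>\<^sub>2\<close> with finite expectation.
\<close>

section \<open>Quantile functions\<close>

text \<open>
  The quantile function of \<open>F\<close>, for monotone \<open>F\<close>. Its value at \<open>u\<close> is \<open>-\<infinity>\<close> if \<open>F\<close> is nowhere
  below \<open>u\<close>, and \<open>\<infinity>\<close> if \<open>F\<close> is everywhere below \<open>u\<close>.
\<close>

definition quantile :: "(real \<Rightarrow> real) \<Rightarrow> real \<Rightarrow> ereal" where
  "quantile F u = Sup (ereal ` {x. F x < u})"

lemma quantile_le:
  assumes "mono F" "u \<le> F s"
  shows "quantile F u \<le> ereal s"
  unfolding quantile_def
proof (rule Sup_least, clarsimp)
  fix x assume "F x < u"
  then have "F x < F s" using assms(2) by simp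
  then show "x \<le> s" using monoD[OF assms(1), of s x] by (cases "x \<le> s") auto
qed

lemma le_quantile: "F s < u \<Longrightarrow> ereal s \<le> quantile F u"
  unfolding quantile_def by (auto intro: Sup_upper)

lemma borel_measurable_quantile [measurable]: "quantile F \<in> borel_measurable borel"
proof (rule borel_measurableI_greater)
  fix y
  have "{u \<in> space borel. y < quantile F u} = (\<Union>x\<in>{x. y < ereal x}. {F x<..})"
    by (auto simp: quantile_def less_Sup_iff)
  then show "{u \<in> space borel. y < quantile F u} \<in> sets borel"
    by (auto intro!: borel_open open_UN)
qed

section \<open>The gain from raising the first utility\<close>

text \<open>
  The change of \<open>max (x + \<epsilon>\<^sub>1) \<epsilon>\<^sub>2\<close> as \<open>x\<close> moves away from 0, where \<open>\<epsilon>\<^sub>2 - \<epsilon>\<^sub>1 = d\<close>. For real \<open>d\<close> it equals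
  \<open>max x d - max 0 d\<close>. The form below is also meaningful for infinite \<open>d\<close>: the maximum is always
  finite, so the conversion to a real number loses nothing.
\<close>

definition gain :: "real \<Rightarrow> ereal \<Rightarrow> real" where
  "gain x d = real_of_ereal (max (ereal x - max 0 d) (min 0 d))"

lemma gain_real [simp]: "gain x (ereal d) = max (x - max 0 d) (min 0 d)"
  by (simp add: gain_def max_def min_def zero_ereal_def)

lemma gain_PInf [simp]: "gain x \<infinity> = 0"
  by (simp add: gain_def max_def min_def)

lemma gain_MInf [simp]: "gain x (-\<infinity>) = x"
  by (simp add: gain_def max_def min_def)

lemma borel_measurable_gain [measurable]: "gain x \<in> borel_measurable borel"
  unfolding gain_def[abs_def] by measurable

lemma gain_0 [simp]: "gain 0 d = 0"
  by (cases d) auto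

lemma gain_mono: "a \<le> b \<Longrightarrow> gain a d \<le> gain b d"
  by (cases d) auto

lemma abs_gain_le: "\<bar>gain x d\<bar> \<le> \<bar>x\<bar>"
  by (cases d) auto

text \<open>The payoff of the better alternative, when the noise terms are chosen as described at the top.\<close>

lemma max_eq_gain:
  "max (ereal a + (ereal c - max 0 d)) (ereal b + (ereal c + min 0 d)) = ereal (b + c + gain (a - b) d)"
  by (cases d) (auto simp: max_def min_def zero_ereal_def)

lemma gain_diff_eq_emeasure:
  assumes "a \<le> b"
  shows "ennreal (gain b d - gain a d) = emeasure lborel {s \<in> {a..b}. d \<le> ereal s}"
proof (cases d)
  case (real r)
  have "{s \<in> {a..b}. d \<le> ereal s} = {max a r..b}" using real by auto
  moreover have "ennreal (gain b d - gain a d) = emeasure lborel {max a r..b}"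
    using assms by (cases "max a r \<le> b") (auto simp: real max_def min_def)
  ultimately show ?thesis by simp
next
  case MInf
  then have "{s \<in> {a..b}. d \<le> ereal s} = {a..b}" by auto
  then show ?thesis using assms MInf by simp
qed (auto simp: assms)

section \<open>Expected gain\<close>

abbreviation unit_uniform :: "real measure" where
  "unit_uniform \<equiv> uniform_measure lborel {0<..<1}"

interpretation unit_uniform: prob_space unit_uniform
  by (rule prob_space_uniform_measure) simp_all

text \<open>
  The core computation. Exchanging the integrals over \<open>u\<close> and \<open>s\<close> turns the expected length of
  \<open>{s \<in> [a, b]. quantile F u \<le> s}\<close> into the integral of \<open>F\<close> over \<open>[a, b]\<close>.
\<close>

lemma nn_integral_gain_diff:
  assumes F: "mono F" "\<And>x. 0 \<le> F x" "\<And>x. F x \<le> 1"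
    and g: "\<And>x. (g has_real_derivative F x) (at x)" and ab: "a \<le> b"
  shows "(\<integral>\<^sup>+u. ennreal (gain b (quantile F u) - gain a (quantile F u)) \<partial>unit_uniform) = ennreal (g b - g a)"
proof -
  have [measurable]: "F \<in> borel_measurable borel"
    by (rule borel_measurable_mono) (rule F)
  have gain: "ennreal (gain b (quantile F u) - gain a (quantile F u)) =
      (\<integral>\<^sup>+s. indicator {s \<in> {a..b}. u \<le> F s} s \<partial>lborel)" for u
  proof -
    \<comment> \<open>Without continuity of \<open>F\<close>, the two conditions may differ, but only at \<open>s = quantile F u\<close>.\<close>
    have "emeasure lborel {s \<in> {a..b}. quantile F u \<le> ereal s} = emeasure lborel {s \<in> {a..b}. u \<le> F s}"
    proof (rule emeasure_eq_AE)
      have "AE s in lborel. s \<notin> {real_of_ereal (quantile F u)}"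
        by (rule AE_not_in) (simp add: finite_imp_null_set_lborel)
      then show "AE s in lborel. s \<in> {s \<in> {a..b}. quantile F u \<le> ereal s} \<longleftrightarrow> s \<in> {s \<in> {a..b}. u \<le> F s}"
      proof eventually_elim
        case (elim s)
        have "u \<le> F s" if "quantile F u \<le> ereal s"
        proof (rule ccontr)
          assume "\<not> u \<le> F s"
          then have "quantile F u = ereal s" using le_quantile[of F s u] that by simp
          with elim show False by simp
        qed
        then show ?case using quantile_le[OF F(1)] by auto
      qed
    qed measurable
    then show ?thesis by (simp add: gain_diff_eq_emeasure[OF ab])
  qed
  have level: "(\<integral>\<^sup>+u. indicator {0<..<1} u * indicator {s \<in> {a..b}. u \<le> F s} s \<partial>lborel)
      = ennreal (F s) * indicator {a..b} s" for s
  proof -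
    have "(\<integral>\<^sup>+u. indicator {0<..<1} u * indicator {s \<in> {a..b}. u \<le> F s} s \<partial>lborel)
      = (\<integral>\<^sup>+u. indicator {0..F s} u * indicator {a..b} s \<partial>lborel)"
    proof (rule nn_integral_cong_AE)
      \<comment> \<open>The integrands differ at most at the end points of the unit interval, since \<open>F s \<le> 1\<close>.\<close>
      have "AE u in lborel. u \<notin> {0, 1::real}"
        by (rule AE_not_in) (simp add: finite_imp_null_set_lborel)
      then show "AE u in lborel. indicator {0<..<1} u * indicator {s \<in> {a..b}. u \<le> F s} s
          = (indicator {0..F s} u * indicator {a..b} s :: ennreal)"
      proof eventually_elim
        case (elim u)
        then show ?case using F(3)[of s] by (auto split: split_indicator)
      qed
    qed
    also have "\<dots> = ennreal (F s) * indicator {a..b} s"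
      by (subst nn_integral_multc) (auto simp: F)
    finally show ?thesis .
  qed
  have "(\<integral>\<^sup>+u. ennreal (gain b (quantile F u) - gain a (quantile F u)) \<partial>unit_uniform)
     = (\<integral>\<^sup>+u. ennreal (gain b (quantile F u) - gain a (quantile F u)) * indicator {0<..<1} u \<partial>lborel)"
    by (subst nn_integral_uniform_measure) (auto simp: divide_ennreal_def)
  also have "\<dots> = (\<integral>\<^sup>+u. (\<integral>\<^sup>+s. indicator {0<..<1} u * indicator {s \<in> {a..b}. u \<le> F s} s \<partial>lborel) \<partial>lborel)"
    by (intro nn_integral_cong) (simp add: gain nn_integral_cmult mult.commute)
  also have "\<dots> = (\<integral>\<^sup>+s. (\<integral>\<^sup>+u. indicator {0<..<1} u * indicator {s \<in> {a..b}. u \<le> F s} s \<partial>lborel) \<partial>lborel)"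
    by (rule lborel_pair.Fubini'[symmetric]) measurable
  also have "\<dots> = (\<integral>\<^sup>+s. ennreal (F s) * indicator {a..b} s \<partial>lborel)"
    by (simp only: level)
  also have "\<dots> = ennreal (g b - g a)"
    using F g ab by (intro nn_integral_FTC_Icc) auto
  finally show ?thesis .
qed

lemma integrable_gain: "integrable unit_uniform (\<lambda>u. gain x (quantile F u))"
  by (rule unit_uniform.integrable_const_bound[where B="\<bar>x\<bar>"]) (auto simp: abs_gain_le)

lemma expectation_gain:
  assumes F: "mono F" "\<And>x. 0 \<le> F x" "\<And>x. F x \<le> 1"
    and g: "\<And>x. (g has_real_derivative F x) (at x)"
  shows "(\<integral>u. gain x (quantile F u) \<partial>unit_uniform) = g x - g 0"
proof -
  have diff: "(\<integral>u. gain b (quantile F u) - gain a (quantile F u) \<partial>unit_uniform) = g b - g a" if "a \<le> b" for a b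
  proof (rule integral_eq_nn_integral[THEN trans])
    have "g a \<le> g b" using DERIV_nonneg_imp_nondecreasing[OF that] F g by blast
    then show "enn2real (\<integral>\<^sup>+u. ennreal (gain b (quantile F u) - gain a (quantile F u)) \<partial>unit_uniform) = g b - g a"
      by (simp add: nn_integral_gain_diff[OF F g that])
  qed (auto simp: gain_mono that)
  show ?thesis
  proof (cases "0 \<le> x")
    case True
    then show ?thesis using diff[of 0 x] by simp
  next
    case False
    then show ?thesis using diff[of x 0] by simp
  qed
qed

section \<open>Integrability of the quantile function\<close>

lemma e2ennreal_eq_SUP: "e2ennreal y = (SUP n::nat. e2ennreal (min (ereal n) y))"
proof (rule antisym)
  show "(SUP n::nat. e2ennreal (min (ereal n) y)) \<le> e2ennreal y"
    by (intro SUP_least e2ennreal_mono) simp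
  show "e2ennreal y \<le> (SUP n::nat. e2ennreal (min (ereal n) y))"
  proof (cases y)
    case (real r)
    obtain n :: nat where "r \<le> n" using real_arch_simple by blast
    then show ?thesis by (intro SUP_upper2[of n]) (auto simp: real min_def)
  next
    case PInf
    then show ?thesis by (simp add: ennreal_of_nat_eq_real_of_nat[symmetric] ennreal_SUP_of_nat_eq_top)
  qed simp
qed

lemma nn_integral_e2ennreal_le:
  assumes [measurable]: "Y \<in> borel_measurable M"
    and "\<And>n::nat. (\<integral>\<^sup>+u. e2ennreal (min (ereal n) (Y u)) \<partial>M) \<le> K"
  shows "(\<integral>\<^sup>+u. e2ennreal (Y u) \<partial>M) \<le> K"
proof -
  have "(\<integral>\<^sup>+u. e2ennreal (Y u) \<partial>M) = (SUP n::nat. \<integral>\<^sup>+u. e2ennreal (min (ereal n) (Y u)) \<partial>M)"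
    by (subst e2ennreal_eq_SUP, rule nn_integral_monotone_convergence_SUP)
       (auto simp: incseq_def le_fun_def intro!: e2ennreal_mono min.mono)
  also have "\<dots> \<le> K" by (intro SUP_least assms)
  finally show ?thesis .
qed

text \<open>
  The positive and the negative part of \<open>d\<close>, truncated at \<open>n\<close>, expressed by gains. The conversion
  \<^const>\<open>e2ennreal\<close> takes positive parts, as it sends negative values to 0.
\<close>

lemma gain_truncation:
  fixes n :: nat
  shows "e2ennreal (min (ereal n) d) = ennreal (n - gain n d)"
    and "e2ennreal (min (ereal n) (- d)) = ennreal (- gain (- real n) d)"
proof -
  have "e2ennreal (min (ereal n) d) = ennreal (n - gain n d) \<and>
      e2ennreal (min (ereal n) (- d)) = ennreal (- gain (- real n) d)"
  proof (cases d)
    case (real r)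
    have "min (ereal n) (ereal s) = ereal (min n s)" for s by (simp add: min_def)
    then show ?thesis
      by (cases "0 \<le> r") (simp_all add: real ennreal_neg min_def max_def)
  next
    case PInf
    then show ?thesis by (simp add: min_def e2ennreal_neg)
  next
    case MInf
    then show ?thesis by (simp add: min_def e2ennreal_neg)
  qed
  then show "e2ennreal (min (ereal n) d) = ennreal (n - gain n d)"
    and "e2ennreal (min (ereal n) (- d)) = ennreal (- gain (- real n) d)" by auto
qed

text \<open>
  The lower bounds on \<open>g\<close> are those that superlinearity of \<open>w\<close> provides for \<open>g x = w (x, 0)\<close>. They
  bound the expected positive part of the quantile by \<open>g 0 - b1\<close> and the negative part by
  \<open>g 0 - b2\<close>.
\<close>

lemma quantile_integrable:
  assumes F: "mono F" "\<And>x. 0 \<le> F x" "\<And>x. F x \<le> 1"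
    and g: "\<And>x. (g has_real_derivative F x) (at x)"
    and lower: "\<And>x. x + b1 \<le> g x" "\<And>x. b2 \<le> g x"
  shows "AE u in unit_uniform. \<bar>quantile F u\<bar> \<noteq> \<infinity>"
    and "integrable unit_uniform (\<lambda>u. real_of_ereal (quantile F u))"
proof -
  have pos: "(\<integral>\<^sup>+u. e2ennreal (quantile F u) \<partial>unit_uniform) \<le> ennreal (g 0 - b1)"
  proof (rule nn_integral_e2ennreal_le)
    fix n :: nat
    have "(\<integral>\<^sup>+u. e2ennreal (min (ereal n) (quantile F u)) \<partial>unit_uniform) = ennreal (\<integral>u. n - gain n (quantile F u) \<partial>unit_uniform)"
      unfolding gain_truncation(1) using abs_gain_le[of "real n"]
      by (intro nn_integral_eq_integral) (auto simp: integrable_gain abs_le_iff)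
    also have "(\<integral>u. n - gain n (quantile F u) \<partial>unit_uniform) = n - (g n - g 0)"
      by (simp add: integrable_gain expectation_gain[OF F g] unit_uniform.prob_space)
    finally show "(\<integral>\<^sup>+u. e2ennreal (min (ereal n) (quantile F u)) \<partial>unit_uniform) \<le> ennreal (g 0 - b1)"
      using lower(1)[of n] by (simp add: ennreal_leI)
  qed simp
  have neg: "(\<integral>\<^sup>+u. e2ennreal (- quantile F u) \<partial>unit_uniform) \<le> ennreal (g 0 - b2)"
  proof (rule nn_integral_e2ennreal_le)
    fix n :: nat
    have "(\<integral>\<^sup>+u. e2ennreal (min (ereal n) (- quantile F u)) \<partial>unit_uniform) = ennreal (\<integral>u. - gain (- real n) (quantile F u) \<partial>unit_uniform)"
      unfolding gain_truncation(2) using gain_mono[of "- real n" 0]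
      by (intro nn_integral_eq_integral) (auto simp: integrable_gain)
    also have "(\<integral>u. - gain (- real n) (quantile F u) \<partial>unit_uniform) = g 0 - g (- real n)"
      by (simp add: integrable_gain expectation_gain[OF F g])
    finally show "(\<integral>\<^sup>+u. e2ennreal (min (ereal n) (- quantile F u)) \<partial>unit_uniform) \<le> ennreal (g 0 - b2)"
      using lower(2)[of "- real n"] by (simp add: ennreal_leI)
  qed simp
  have "AE u in unit_uniform. e2ennreal (quantile F u) \<noteq> \<infinity>"
    using pos by (intro nn_integral_noteq_infinite) (auto simp: top_unique)
  moreover have "AE u in unit_uniform. e2ennreal (- quantile F u) \<noteq> \<infinity>"
    using neg by (intro nn_integral_noteq_infinite) (auto simp: top_unique)
  ultimately show "AE u in unit_uniform. \<bar>quantile F u\<bar> \<noteq> \<infinity>"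
    by eventually_elim auto
  show "integrable unit_uniform (\<lambda>u. real_of_ereal (quantile F u))"
  proof (rule integrableI_bounded)
    have "ennreal (norm (real_of_ereal d)) \<le> e2ennreal d + e2ennreal (- d)" for d
      by (cases d) (auto simp: abs_if)
    then have "(\<integral>\<^sup>+u. ennreal (norm (real_of_ereal (quantile F u))) \<partial>unit_uniform)
      \<le> (\<integral>\<^sup>+u. e2ennreal (quantile F u) + e2ennreal (- quantile F u) \<partial>unit_uniform)"
      by (intro nn_integral_mono)
    also have "\<dots> = (\<integral>\<^sup>+u. e2ennreal (quantile F u) \<partial>unit_uniform) + (\<integral>\<^sup>+u. e2ennreal (- quantile F u) \<partial>unit_uniform)"
      by (rule nn_integral_add) auto
    also have "\<dots> < \<infinity>" using order.strict_trans1[OF pos] order.strict_trans1[OF neg] by simp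
    finally show "(\<integral>\<^sup>+u. ennreal (norm (real_of_ereal (quantile F u))) \<partial>unit_uniform) < \<infinity>" .
  qed simp
qed

section \<open>Extended-real expectations\<close>

lemma ereal_expectation_distr:
  assumes [measurable]: "T \<in> M \<rightarrow>\<^sub>M N" "X \<in> borel_measurable N"
  shows "ereal_expectation (distr M N T) X = ereal_expectation M (\<lambda>u. X (T u))"
  unfolding ereal_expectation_def by (simp add: nn_integral_distr)

lemma ereal_expectation_ereal:
  assumes "integrable M Y"
  shows "ereal_expectation M (\<lambda>u. ereal (Y u)) = ereal (\<integral>u. Y u \<partial>M)"
proof -
  have "(\<integral>\<^sup>+u. ennreal (Y u) \<partial>M) \<noteq> \<infinity>" "(\<integral>\<^sup>+u. ennreal (- Y u) \<partial>M) \<noteq> \<infinity>"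
    using assms by (auto simp: real_integrable_def)
  then show ?thesis
    unfolding ereal_expectation_def real_lebesgue_integral_def[OF assms]
    by (cases "\<integral>\<^sup>+u. ennreal (Y u) \<partial>M"; cases "\<integral>\<^sup>+u. ennreal (- Y u) \<partial>M") auto
qed

section \<open>Choice welfare functions of two alternatives\<close>

text \<open>
  The upper bound on \<open>F\<close> holds because \<open>x - g x\<close> is nondecreasing as well: raising only the first
  utility by \<open>t\<close> gains at most what raising both utilities by \<open>t\<close> does.
\<close>

lemma differentiable_cwf_reduction:
  fixes w :: "real^2 \<Rightarrow> real"
  assumes "differentiable_cwf w"
  obtains g F where "\<And>\<mu>. w \<mu> = g (\<mu> $ 1 - \<mu> $ 2) + \<mu> $ 2"
    "\<And>x. (g has_real_derivative F x) (at x)" "mono F" "\<And>x. 0 \<le> F x" "\<And>x. F x \<le> 1"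
proof -
  have diff: "w differentiable (at \<mu>)" and "mono w" and cvx: "convex_on UNIV w"
    and trans: "w (\<mu> + t *\<^sub>R (\<chi> i. 1)) = w \<mu> + t" for \<mu> t
    using assms by (auto simp: differentiable_cwf_def)
  define g where "g x = w (x *\<^sub>R axis 1 1)" for x
  define F where "F = deriv g"
  have w_eq: "w \<mu> = g (\<mu> $ 1 - \<mu> $ 2) + \<mu> $ 2" for \<mu>
  proof -
    have "\<mu> = (\<mu> $ 1 - \<mu> $ 2) *\<^sub>R axis 1 1 + \<mu> $ 2 *\<^sub>R (\<chi> i. 1)"
      by (simp add: vec_eq_iff forall_2 axis_def)
    then show ?thesis using trans[of "(\<mu> $ 1 - \<mu> $ 2) *\<^sub>R axis 1 1" "\<mu> $ 2"] by (simp add: g_def)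
  qed
  have deriv: "(g has_real_derivative F x) (at x)" for x
  proof -
    have "(w \<circ> (\<lambda>x. x *\<^sub>R axis 1 1)) differentiable (at x)"
      by (intro differentiable_chain_at diff) simp
    then have "g differentiable (at x)" by (simp add: g_def[abs_def] comp_def)
    then show ?thesis unfolding F_def using DERIV_deriv_iff_real_differentiable by blast
  qed
  have "mono g"
    using \<open>mono w\<close> by (auto simp: mono_def g_def less_eq_vec_def axis_def)
  have "mono (\<lambda>x. x - g x)"
  proof (rule monoI)
    fix x y :: real assume "x \<le> y"
    then have "w (y *\<^sub>R axis 1 1) \<le> w (x *\<^sub>R axis 1 1 + (y - x) *\<^sub>R (\<chi> i. 1))"
      by (intro monoD[OF \<open>mono w\<close>]) (auto simp: less_eq_vec_def axis_def)
    then show "x - g x \<le> y - g y" by (simp add: trans g_def)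
  qed
  have cvx_g: "convex_on UNIV g"
  proof (rule convex_onI)
    fix t x y :: real assume "0 < t" "t < 1"
    then show "g ((1 - t) *\<^sub>R x + t *\<^sub>R y) \<le> (1 - t) * g x + t * g y"
      using convex_onD[OF cvx, of t "x *\<^sub>R axis 1 1" "y *\<^sub>R axis 1 1"]
      by (simp add: g_def scaleR_add_left)
  qed simp
  have tangent: "F x * (y - x) \<le> g y - g x" for x y
    by (rule convex_on_imp_above_tangent[OF cvx_g]) (auto simp: deriv)
  have "mono F"
  proof (rule monoI)
    fix x y :: real assume "x \<le> y"
    have "0 \<le> (F y - F x) * (y - x)"
      using tangent[of x y] tangent[of y x] by (simp add: algebra_simps)
    then show "F x \<le> F y" using \<open>x \<le> y\<close> by (cases "x = y") (auto simp: zero_le_mult_iff)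
  qed
  moreover have "0 \<le> F x" for x
    by (rule mono_on_imp_deriv_nonneg[OF _ deriv, of UNIV]) (auto simp: \<open>mono g\<close>)
  moreover have "F x \<le> 1" for x
  proof -
    have "((\<lambda>x. x - g x) has_real_derivative 1 - F x) (at x)"
      by (intro derivative_intros deriv)
    then have "0 \<le> 1 - F x"
      by (rule mono_on_imp_deriv_nonneg[rotated, of _ _ _ UNIV]) (auto simp: \<open>mono (\<lambda>x. x - g x)\<close>)
    then show ?thesis by simp
  qed
  ultimately show ?thesis using that w_eq deriv by blast
qed

section \<open>Representation by random utilities\<close>

theorem theorem4:
  fixes w :: "real^2 \<Rightarrow> real"
  assumes "differentiable_cwf w"
  shows "(\<exists>\<theta> :: (ereal \<times> ereal) measure.
            prob_space \<theta> \<and>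
            sets \<theta> = sets (restrict_space borel (real_or_minf \<times> real_or_minf)) \<and>
            (\<forall>\<mu>. ereal (w \<mu>) =
               ereal_expectation \<theta> (\<lambda>(\<epsilon>1, \<epsilon>2). max (ereal (\<mu> $ 1) + \<epsilon>1) (ereal (\<mu> $ 2) + \<epsilon>2)))) \<and>
         (superlinear w \<longrightarrow>
          (\<exists>\<theta> :: (real \<times> real) measure.
            prob_space \<theta> \<and>
            sets \<theta> = sets borel \<and>
            integrable \<theta> (\<lambda>(\<epsilon>1, \<epsilon>2). \<bar>\<epsilon>1\<bar>) \<and>
            integrable \<theta> (\<lambda>(\<epsilon>1, \<epsilon>2). \<bar>\<epsilon>2\<bar>) \<and>
            (\<forall>\<mu>. w \<mu> = (\<integral>(\<epsilon>1, \<epsilon>2). max (\<mu> $ 1 + \<epsilon>1) (\<mu> $ 2 + \<epsilon>2) \<partial>\<theta>))))"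
proof -
  obtain g F where w: "\<And>\<mu>. w \<mu> = g (\<mu> $ 1 - \<mu> $ 2) + \<mu> $ 2"
    and g: "\<And>x. (g has_real_derivative F x) (at x)"
    and F: "mono F" "\<And>x. 0 \<le> F x" "\<And>x. F x \<le> 1"
    using differentiable_cwf_reduction[OF assms] by blast
  let ?q = "quantile F"
  let ?c = "g 0"
  have expectation: "(\<integral>u. \<mu> $ 2 + ?c + gain (\<mu> $ 1 - \<mu> $ 2) (?q u) \<partial>unit_uniform) = w \<mu>" for \<mu>
    by (simp add: integrable_gain expectation_gain[OF F g] unit_uniform.prob_space w)
  show ?thesis
  proof (intro conjI impI)
    let ?N = "restrict_space borel (real_or_minf \<times> real_or_minf) :: (ereal \<times> ereal) measure"
    define T where "T u = (ereal ?c - max 0 (?q u), ereal ?c + min 0 (?q u))" for u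
    have "ereal c - max 0 d \<in> real_or_minf" "ereal c + min 0 d \<in> real_or_minf" for c d
      by (cases d; auto simp: real_or_minf_def max_def min_def zero_ereal_def)+
    then have T: "T \<in> unit_uniform \<rightarrow>\<^sub>M ?N"
      unfolding T_def[abs_def] by (intro measurable_restrict_space2) (auto simp flip: borel_prod)
    have X: "(\<lambda>(\<epsilon>1, \<epsilon>2). max (ereal a + \<epsilon>1) (ereal b + \<epsilon>2)) \<in> borel_measurable ?N" for a b
      by (intro measurable_restrict_space1) (simp flip: borel_prod)
    show "\<exists>\<theta> :: (ereal \<times> ereal) measure.
            prob_space \<theta> \<and>
            sets \<theta> = sets (restrict_space borel (real_or_minf \<times> real_or_minf)) \<and>
            (\<forall>\<mu>. ereal (w \<mu>) =
               ereal_expectation \<theta> (\<lambda>(\<epsilon>1, \<epsilon>2). max (ereal (\<mu> $ 1) + \<epsilon>1) (ereal (\<mu> $ 2) + \<epsilon>2)))"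
    proof (intro exI[of _ "distr unit_uniform ?N T"] conjI allI)
      show "prob_space (distr unit_uniform ?N T)"
        by (rule unit_uniform.prob_space_distr[OF T])
      fix \<mu> :: "real^2"
      show "ereal (w \<mu>) = ereal_expectation (distr unit_uniform ?N T)
          (\<lambda>(\<epsilon>1, \<epsilon>2). max (ereal (\<mu> $ 1) + \<epsilon>1) (ereal (\<mu> $ 2) + \<epsilon>2))"
        by (simp add: ereal_expectation_distr[OF T X] T_def max_eq_gain
            ereal_expectation_ereal integrable_gain expectation del: plus_ereal.simps)
    qed simp
  next
    assume "superlinear w"
    then obtain b :: "2 \<Rightarrow> real" where b: "\<And>\<mu> i. \<mu> $ i + b i \<le> w \<mu>"
      by (auto simp: superlinear_def)
    have lower: "x + b 1 \<le> g x" "b 2 \<le> g x" for x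
      using b[of "x *\<^sub>R axis 1 1" 1] b[of "x *\<^sub>R axis 1 1" 2] by (auto simp: w axis_def)
    define d where "d u = real_of_ereal (?q u)" for u
    have [measurable]: "d \<in> borel_measurable borel"
      unfolding d_def[abs_def] by measurable
    have finite: "AE u in unit_uniform. \<bar>?q u\<bar> \<noteq> \<infinity>" and d: "integrable unit_uniform d"
      using quantile_integrable[OF F g lower] by (auto simp: d_def[abs_def])
    define T where "T u = (?c - max 0 (d u), ?c + min 0 (d u))" for u
    have T: "T \<in> unit_uniform \<rightarrow>\<^sub>M borel"
      unfolding T_def[abs_def] by (simp flip: borel_prod)
    show "\<exists>\<theta> :: (real \<times> real) measure.
            prob_space \<theta> \<and>
            sets \<theta> = sets borel \<and>
            integrable \<theta> (\<lambda>(\<epsilon>1, \<epsilon>2). \<bar>\<epsilon>1\<bar>) \<and>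
            integrable \<theta> (\<lambda>(\<epsilon>1, \<epsilon>2). \<bar>\<epsilon>2\<bar>) \<and>
            (\<forall>\<mu>. w \<mu> = (\<integral>(\<epsilon>1, \<epsilon>2). max (\<mu> $ 1 + \<epsilon>1) (\<mu> $ 2 + \<epsilon>2) \<partial>\<theta>))"
    proof (intro exI[of _ "distr unit_uniform borel T"] conjI allI)
      show "prob_space (distr unit_uniform borel T)"
        by (rule unit_uniform.prob_space_distr[OF T])
      have "integrable unit_uniform (\<lambda>u. \<bar>?c - max 0 (d u)\<bar>)" "integrable unit_uniform (\<lambda>u. \<bar>?c + min 0 (d u)\<bar>)"
        by (auto intro!: d integrable_abs integrable_max integrable_min)
      then show "integrable (distr unit_uniform borel T) (\<lambda>(\<epsilon>1, \<epsilon>2). \<bar>\<epsilon>1\<bar>)"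
        "integrable (distr unit_uniform borel T) (\<lambda>(\<epsilon>1, \<epsilon>2). \<bar>\<epsilon>2\<bar>)"
        by (subst integrable_distr_eq[OF T]; simp add: T_def flip: borel_prod)+
      fix \<mu> :: "real^2"
      have "(\<integral>(\<epsilon>1, \<epsilon>2). max (\<mu> $ 1 + \<epsilon>1) (\<mu> $ 2 + \<epsilon>2) \<partial>distr unit_uniform borel T)
          = (\<integral>u. max (\<mu> $ 1 + (?c - max 0 (d u))) (\<mu> $ 2 + (?c + min 0 (d u))) \<partial>unit_uniform)"
        by (subst integral_distr[OF T]) (auto simp: T_def simp flip: borel_prod)
      also have "\<dots> = (\<integral>u. \<mu> $ 2 + ?c + gain (\<mu> $ 1 - \<mu> $ 2) (?q u) \<partial>unit_uniform)"
      proof (rule integral_cong_AE)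
        show "AE u in unit_uniform. max (\<mu> $ 1 + (?c - max 0 (d u))) (\<mu> $ 2 + (?c + min 0 (d u)))
            = \<mu> $ 2 + ?c + gain (\<mu> $ 1 - \<mu> $ 2) (?q u)"
          using finite
        proof eventually_elim
          case (elim u)
          then have "?q u = ereal (d u)" by (auto simp: d_def ereal_real)
          then show ?case by auto
        qed
      qed simp_all
      also have "\<dots> = w \<mu>" by (rule expectation)
      finally show "w \<mu> = (\<integral>(\<epsilon>1, \<epsilon>2). max (\<mu> $ 1 + \<epsilon>1) (\<mu> $ 2 + \<epsilon>2) \<partial>distr unit_uniform borel T)" ..
    qed simp
  qed
qed

end
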